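(* The bounded linear operator $\overline{\partial}\colon C^1_{\mathbb{R}}(\mathbb{D},\mathbb{C})\rightarrow C^0(\mathbb{D},\mathbb{C})$ is not Fredholm.
   Context: $\mathbb{D}\subset\mathbb{C}$ is the closed unit disc. $C^1_{\mathbb{R}}(\mathbb{D},\mathbb{C})$ is the real Banach space, with the $C^1$-norm, of $C^1$-maps $u\colon\mathbb{D}\to\mathbb{C}$ (real differentiability, with first derivatives continuous up to the boundary) with real boundary values, i.e. $u(\partial\mathbb{D})\subset\mathbb{R}$. $C^0(\mathbb{D},\mathbb{C})$ is the Banach space of continuous maps $\mathbb{D}\to\mathbb{C}$ with the supremum norm. The Cauchy--Riemann operator is $\overline{\partial}:=\frac{1}{2}(\partial_x+\mathrm{i}\,\partial_y)$, where $z=x+\mathrm{i}y$; it is regarded as a real-linear operator. A bounded linear operator between Banach spaces is Fredholm if its kernel and its cokernel are finite-dimensional (in particular its image is then closed). *)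

theory Defs
  imports "HOL-Analysis.Analysis"
begin

typedef disc = "cball (0::complex) 1"
  morphisms of_disc to_disc
  by (auto intro: exI[of _ 0])

instantiation disc :: metric_space
begin

definition dist_disc :: "disc \<Rightarrow> disc \<Rightarrow> real"
  where "dist_disc x y = dist (of_disc x) (of_disc y)"

definition uniformity_disc :: "(disc \<times> disc) filter"
  where "uniformity_disc = (INF e\<in>{0 <..}. principal {(x, y). dist x y < e})"

definition open_disc :: "disc set \<Rightarrow> bool"
  where "open_disc S = (\<forall>x\<in>S. \<forall>\<^sub>F (x', y) in uniformity. x' = x \<longrightarrow> y \<in> S)"

instance
proof
  fix x y z :: disc
  show "dist x y = 0 \<longleftrightarrow> x = y"
    by (simp add: dist_disc_def of_disc_inject)
  show "dist x y \<le> dist x z + dist y z"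
    unfolding dist_disc_def by (rule dist_triangle2)
qed (rule uniformity_disc_def open_disc_def)+

end

lemma continuous_on_to_disc: "continuous_on (cball 0 1) to_disc"
  unfolding continuous_on_iff dist_disc_def by (auto simp: to_disc_inverse)

lemma to_disc_image: "to_disc ` cball 0 1 = UNIV"
  by (auto intro!: image_eqI[of _ to_disc, OF of_disc_inverse[symmetric] of_disc])

text \<open>
  Since the disc is compact, every continuous map on it is bounded, so that
  \<^typ>\<open>disc \<Rightarrow>\<^sub>C complex\<close> consists of all continuous maps from the disc to \<^typ>\<open>complex\<close>,
  with the supremum norm.
\<close>

lemma compact_disc: "compact (UNIV :: disc set)"
  using compact_continuous_image[OF continuous_on_to_disc] by (simp add: to_disc_image)

lemma bcontfun_disc:
  fixes f :: "disc \<Rightarrow> 'b::metric_space"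
  shows "f \<in> bcontfun \<longleftrightarrow> continuous_on UNIV f"
  using compact_continuous_image[of UNIV f, OF _ compact_disc]
  by (auto simp: bcontfun_def intro: compact_imp_bounded)

text \<open>
  At a boundary point the derivative is taken relative to the closed disc. As the disc is convex
  and the partial derivatives are required to be continuous on all of it, this agrees with
  differentiability in the open disc with partial derivatives that extend continuously to the
  boundary. The argument of \<^const>\<open>to_disc\<close> is only ever relevant inside the closed disc.
\<close>

definition has_partials ::
  "(disc \<Rightarrow>\<^sub>C complex) \<Rightarrow> (disc \<Rightarrow>\<^sub>C complex) \<Rightarrow> (disc \<Rightarrow>\<^sub>C complex) \<Rightarrow> bool"
  where "has_partials u ux uy \<longleftrightarrow>
    (\<forall>z. ((\<lambda>w. u (to_disc w)) has_derivative (\<lambda>h. Re h *\<^sub>R ux z + Im h *\<^sub>R uy z))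
            (at (of_disc z) within cball 0 1))"

lemma has_partials_zero: "has_partials 0 0 0"
  by (simp add: has_partials_def)

lemma has_partials_add:
  assumes "has_partials u p q" "has_partials v r s"
  shows "has_partials (u + v) (p + r) (q + s)"
  unfolding has_partials_def
proof
  fix z
  show "((\<lambda>w. (u + v) (to_disc w)) has_derivative
      (\<lambda>h. Re h *\<^sub>R (p + r) z + Im h *\<^sub>R (q + s) z)) (at (of_disc z) within cball 0 1)"
    using has_derivative_add[OF assms[unfolded has_partials_def, rule_format, of z]]
    by (simp only: plus_bcontfun.rep_eq scaleR_add_right add.assoc add.left_commute)
qed

lemma has_partials_scaleR:
  assumes "has_partials u p q"
  shows "has_partials (c *\<^sub>R u) (c *\<^sub>R p) (c *\<^sub>R q)"
  unfolding has_partials_def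
proof
  fix z
  show "((\<lambda>w. (c *\<^sub>R u) (to_disc w)) has_derivative
      (\<lambda>h. Re h *\<^sub>R (c *\<^sub>R p) z + Im h *\<^sub>R (c *\<^sub>R q) z)) (at (of_disc z) within cball 0 1)"
    using has_derivative_scaleR_right[OF assms[unfolded has_partials_def, rule_format, of z], of c]
    by (simp only: scaleR_bcontfun.rep_eq scaleR_add_right scaleR_left_commute[of c])
qed

lemma has_partials_unique:
  assumes "has_partials u p q" "has_partials u r s"
  shows "p = r" "q = s"
proof -
  have eq: "p (to_disc w) = r (to_disc w) \<and> q (to_disc w) = s (to_disc w)" if w: "w \<in> ball 0 1" for w
  proof -
    have z: "of_disc (to_disc w) = w"
      using w by (intro to_disc_inverse) auto
    have at: "at w within cball 0 1 = at w"
      using w by (intro at_within_interior) auto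
    have "(\<lambda>h. Re h *\<^sub>R p (to_disc w) + Im h *\<^sub>R q (to_disc w)) =
          (\<lambda>h. Re h *\<^sub>R r (to_disc w) + Im h *\<^sub>R s (to_disc w))"
    proof (rule has_derivative_unique)
      show "((\<lambda>w. u (to_disc w)) has_derivative
          (\<lambda>h. Re h *\<^sub>R p (to_disc w) + Im h *\<^sub>R q (to_disc w))) (at w)"
        using assms(1)[unfolded has_partials_def, THEN spec, of "to_disc w"] by (simp only: z at)
      show "((\<lambda>w. u (to_disc w)) has_derivative
          (\<lambda>h. Re h *\<^sub>R r (to_disc w) + Im h *\<^sub>R s (to_disc w))) (at w)"
        using assms(2)[unfolded has_partials_def, THEN spec, of "to_disc w"] by (simp only: z at)
    qed
    from fun_cong[OF this, of 1] fun_cong[OF this, of \<i>] show ?thesis by simp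
  qed
  have ext: "f = g" if "\<And>w. w \<in> ball 0 1 \<Longrightarrow> f (to_disc w) = g (to_disc w)"
    for f g :: "disc \<Rightarrow>\<^sub>C complex"
  proof (rule bcontfun_eqI)
    fix z
    have "continuous_on (cball 0 1) (\<lambda>w. f (to_disc w) - g (to_disc w))"
      by (intro continuous_on_diff
          continuous_on_compose2[OF continuous_on_apply_bcontfun continuous_on_to_disc subset_UNIV])
    then have "continuous_on (closure (ball 0 1)) (\<lambda>w. f (to_disc w) - g (to_disc w))"
      by simp
    then have "f (to_disc (of_disc z)) - g (to_disc (of_disc z)) = 0"
      by (rule continuous_constant_on_closure) (use that of_disc[of z] in simp_all)
    then show "f z = g z" by (simp add: of_disc_inverse)
  qed
  show "p = r" by (rule ext) (use eq in blast)
  show "q = s" by (rule ext) (use eq in blast)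
qed

lemma has_partials_limit:
  assumes "\<And>n. has_partials (u n) (p n) (q n)"
    and "u \<longlonglongrightarrow> u'" "p \<longlonglongrightarrow> p'" "q \<longlonglongrightarrow> q'"
  shows "has_partials u' p' q'"
proof -
  have "\<exists>g. \<forall>x\<in>cball 0 1. (\<lambda>n. u n (to_disc x)) \<longlonglongrightarrow> g x \<and>
      (g has_derivative (\<lambda>h. Re h *\<^sub>R p' (to_disc x) + Im h *\<^sub>R q' (to_disc x))) (at x within cball 0 1)"
  proof (rule has_derivative_sequence)
    show "((\<lambda>w. u n (to_disc w)) has_derivative
        (\<lambda>h. Re h *\<^sub>R p n (to_disc x) + Im h *\<^sub>R q n (to_disc x))) (at x within cball 0 1)"
      if "x \<in> cball 0 1" for n x
      using assms(1)[of n, unfolded has_partials_def, rule_format, of "to_disc x"] that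
      by (simp add: to_disc_inverse)
    show "\<forall>\<^sub>F n in sequentially. \<forall>x\<in>cball 0 1. \<forall>h.
        norm (Re h *\<^sub>R p n (to_disc x) + Im h *\<^sub>R q n (to_disc x) -
          (Re h *\<^sub>R p' (to_disc x) + Im h *\<^sub>R q' (to_disc x))) \<le> e * norm h"
      if "e > 0" for e
    proof -
      have "e / 2 > 0" using that by simp
      have "\<forall>\<^sub>F n in sequentially. dist (p n) p' < e / 2 \<and> dist (q n) q' < e / 2"
        using tendstoD[OF assms(3) \<open>e / 2 > 0\<close>] tendstoD[OF assms(4) \<open>e / 2 > 0\<close>]
        by (rule eventually_conj)
      then show ?thesis
      proof (rule eventually_mono, intro ballI allI)
        fix n x and h :: complex
        assume d: "dist (p n) p' < e / 2 \<and> dist (q n) q' < e / 2"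
        let ?z = "to_disc x"
        have P: "norm (p n ?z - p' ?z) \<le> e / 2" and Q: "norm (q n ?z - q' ?z) \<le> e / 2"
          using dist_bounded[of "p n" ?z p'] dist_bounded[of "q n" ?z q'] d
          by (simp_all add: dist_norm)
        have "norm (Re h *\<^sub>R p n ?z + Im h *\<^sub>R q n ?z - (Re h *\<^sub>R p' ?z + Im h *\<^sub>R q' ?z)) =
            norm (Re h *\<^sub>R (p n ?z - p' ?z) + Im h *\<^sub>R (q n ?z - q' ?z))"
          by (simp add: algebra_simps)
        also have "\<dots> \<le> norm (Re h *\<^sub>R (p n ?z - p' ?z)) + norm (Im h *\<^sub>R (q n ?z - q' ?z))"
          by (rule norm_triangle_ineq)
        also have "\<dots> = \<bar>Re h\<bar> * norm (p n ?z - p' ?z) + \<bar>Im h\<bar> * norm (q n ?z - q' ?z)"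
          by simp
        also have "\<dots> \<le> norm h * (e / 2) + norm h * (e / 2)"
          using P Q by (intro add_mono mult_mono abs_Re_le_cmod abs_Im_le_cmod) auto
        finally show "norm (Re h *\<^sub>R p n ?z + Im h *\<^sub>R q n ?z -
            (Re h *\<^sub>R p' ?z + Im h *\<^sub>R q' ?z)) \<le> e * norm h"
          by (simp add: algebra_simps)
      qed
    qed
    show "(\<lambda>n. u n (to_disc 0)) \<longlonglongrightarrow> u' (to_disc 0)"
      by (rule tendsto_uniform_limitI[OF tendsto_bcontfun_uniform_limit[OF assms(2)]]) simp
  qed auto
  then obtain g where g: "\<And>x. x \<in> cball 0 1 \<Longrightarrow> (\<lambda>n. u n (to_disc x)) \<longlonglongrightarrow> g x"
    "\<And>x. x \<in> cball 0 1 \<Longrightarrow>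
      (g has_derivative (\<lambda>h. Re h *\<^sub>R p' (to_disc x) + Im h *\<^sub>R q' (to_disc x))) (at x within cball 0 1)"
    by blast
  have "g x = u' (to_disc x)" if "x \<in> cball 0 1" for x
    using g(1)[OF that] tendsto_uniform_limitI[OF tendsto_bcontfun_uniform_limit[OF assms(2)], of "to_disc x"]
    by (blast intro: LIMSEQ_unique)
  then have deriv: "((\<lambda>x. u' (to_disc x)) has_derivative
      (\<lambda>h. Re h *\<^sub>R p' (to_disc x) + Im h *\<^sub>R q' (to_disc x))) (at x within cball 0 1)"
    if "x \<in> cball 0 1" for x
    using that by (intro has_derivative_transform[OF _ _ g(2)]) simp_all
  show ?thesis
    unfolding has_partials_def
  proof
    fix z
    show "((\<lambda>x. u' (to_disc x)) has_derivative (\<lambda>h. Re h *\<^sub>R p' z + Im h *\<^sub>R q' z))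
        (at (of_disc z) within cball 0 1)"
      using deriv[OF of_disc[of z]] by (simp only: of_disc_inverse)
  qed
qed

typedef c1_real =
  "{u :: disc \<Rightarrow>\<^sub>C complex.
      (\<exists>ux uy. has_partials u ux uy) \<and> (\<forall>z. of_disc z \<in> sphere 0 1 \<longrightarrow> u z \<in> \<real>)}"
  morphisms c1_fun Abs_c1_real
  using has_partials_zero by (auto intro!: exI[of _ 0])

setup_lifting type_definition_c1_real

definition dx :: "c1_real \<Rightarrow> (disc \<Rightarrow>\<^sub>C complex)"
  where "dx u = (THE ux. \<exists>uy. has_partials (c1_fun u) ux uy)"

definition dy :: "c1_real \<Rightarrow> (disc \<Rightarrow>\<^sub>C complex)"
  where "dy u = (THE uy. \<exists>ux. has_partials (c1_fun u) ux uy)"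

lemma dx_dy_eqI:
  assumes "has_partials (c1_fun u) p q"
  shows "dx u = p" "dy u = q"
  using assms has_partials_unique unfolding dx_def dy_def by blast+

lemma has_partials_dx_dy: "has_partials (c1_fun u) (dx u) (dy u)"
  using c1_fun[of u] dx_dy_eqI[of u] by auto

instantiation c1_real :: real_vector
begin

lift_definition zero_c1_real :: c1_real is 0
  using has_partials_zero by auto

lift_definition plus_c1_real :: "c1_real \<Rightarrow> c1_real \<Rightarrow> c1_real" is "(+)"
  using has_partials_add by (auto intro!: Reals_add) blast

lift_definition scaleR_c1_real :: "real \<Rightarrow> c1_real \<Rightarrow> c1_real" is "(*\<^sub>R)"
  using has_partials_scaleR by (auto simp: scaleR_conv_of_real intro!: Reals_mult) blast

definition uminus_c1_real :: "c1_real \<Rightarrow> c1_real"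
  where "uminus_c1_real u = (- 1) *\<^sub>R u"

definition minus_c1_real :: "c1_real \<Rightarrow> c1_real \<Rightarrow> c1_real"
  where "minus_c1_real u v = u + (- v)"

instance
proof
  fix a b c :: c1_real and r s :: real
  show "a + b + c = a + (b + c)" by transfer (simp add: add.assoc)
  show "a + b = b + a" by transfer (simp add: add.commute)
  show "0 + a = a" by transfer simp
  show "- a + a = 0" unfolding uminus_c1_real_def by transfer simp
  show "a - b = a + - b" by (rule minus_c1_real_def)
  show "r *\<^sub>R (a + b) = r *\<^sub>R a + r *\<^sub>R b" by transfer (simp add: scaleR_add_right)
  show "(r + s) *\<^sub>R a = r *\<^sub>R a + s *\<^sub>R a" by transfer (simp add: scaleR_add_left)
  show "r *\<^sub>R s *\<^sub>R a = (r * s) *\<^sub>R a" by transfer simp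
  show "1 *\<^sub>R a = a" by transfer simp
qed

end

lemma c1_fun_simps:
  "c1_fun 0 = 0" "c1_fun (u + v) = c1_fun u + c1_fun v" "c1_fun (c *\<^sub>R u) = c *\<^sub>R c1_fun u"
  "c1_fun (u - v) = c1_fun u - c1_fun v"
  unfolding minus_c1_real_def uminus_c1_real_def
    zero_c1_real.rep_eq plus_c1_real.rep_eq scaleR_c1_real.rep_eq
  by simp_all

lemma dx_dy_add: "dx (u + v) = dx u + dx v" "dy (u + v) = dy u + dy v"
  by (rule dx_dy_eqI, unfold c1_fun_simps, rule has_partials_add[OF has_partials_dx_dy has_partials_dx_dy])+

lemma dx_dy_scaleR: "dx (c *\<^sub>R u) = c *\<^sub>R dx u" "dy (c *\<^sub>R u) = c *\<^sub>R dy u"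
  by (rule dx_dy_eqI, unfold c1_fun_simps, rule has_partials_scaleR[OF has_partials_dx_dy])+

lemma dx_dy_zero: "dx 0 = 0" "dy 0 = 0"
  by (rule dx_dy_eqI, unfold c1_fun_simps, rule has_partials_zero)+

lemma dx_dy_diff: "dx (u - v) = dx u - dx v" "dy (u - v) = dy u - dy v"
  unfolding minus_c1_real_def uminus_c1_real_def dx_dy_add dx_dy_scaleR
  by simp_all

instantiation c1_real :: real_normed_vector
begin

definition norm_c1_real :: "c1_real \<Rightarrow> real"
  where "norm_c1_real u = norm (c1_fun u) + norm (dx u) + norm (dy u)"

definition dist_c1_real :: "c1_real \<Rightarrow> c1_real \<Rightarrow> real"
  where "dist_c1_real u v = norm (u - v)"

definition sgn_c1_real :: "c1_real \<Rightarrow> c1_real"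
  where "sgn_c1_real u = u /\<^sub>R norm u"

definition uniformity_c1_real :: "(c1_real \<times> c1_real) filter"
  where "uniformity_c1_real = (INF e\<in>{0 <..}. principal {(x, y). dist x y < e})"

definition open_c1_real :: "c1_real set \<Rightarrow> bool"
  where "open_c1_real S = (\<forall>x\<in>S. \<forall>\<^sub>F (x', y) in uniformity. x' = x \<longrightarrow> y \<in> S)"

instance
proof
  fix u v :: c1_real and c :: real
  show "norm u = 0 \<longleftrightarrow> u = 0"
  proof
    assume "norm u = 0"
    moreover have "norm (c1_fun u) \<ge> 0" "norm (dx u) \<ge> 0" "norm (dy u) \<ge> 0" by simp_all
    ultimately have "norm (c1_fun u) = 0" unfolding norm_c1_real_def by linarith
    then have "c1_fun u = c1_fun 0" by (simp add: c1_fun_simps)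
    then show "u = 0" by (simp only: c1_fun_inject)
  qed (simp add: norm_c1_real_def c1_fun_simps dx_dy_zero)
  show "norm (u + v) \<le> norm u + norm v"
    using norm_triangle_ineq[of "c1_fun u" "c1_fun v"] norm_triangle_ineq[of "dx u" "dx v"]
      norm_triangle_ineq[of "dy u" "dy v"]
    by (simp add: norm_c1_real_def c1_fun_simps dx_dy_add)
  show "norm (c *\<^sub>R u) = \<bar>c\<bar> * norm u"
    by (simp add: norm_c1_real_def c1_fun_simps dx_dy_scaleR algebra_simps)
qed (rule dist_c1_real_def sgn_c1_real_def uniformity_c1_real_def open_c1_real_def)+

end

instance c1_real :: banach
proof
  fix u :: "nat \<Rightarrow> c1_real"
  assume "Cauchy u"
  have C: "Cauchy (\<lambda>n. f (u n))"
    if f: "\<And>v w. norm (f v - f w) \<le> norm (v - w)" for f :: "c1_real \<Rightarrow> disc \<Rightarrow>\<^sub>C complex"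
  proof (rule metric_CauchyI)
    fix e :: real
    assume "e > 0"
    from metric_CauchyD[OF \<open>Cauchy u\<close> this] f
    show "\<exists>M. \<forall>m\<ge>M. \<forall>n\<ge>M. dist (f (u m)) (f (u n)) < e"
      unfolding dist_norm by (blast intro: le_less_trans)
  qed
  have le: "norm (c1_fun v - c1_fun w) \<le> norm (v - w)" "norm (dx v - dx w) \<le> norm (v - w)"
    "norm (dy v - dy w) \<le> norm (v - w)" for v w
    by (simp_all add: norm_c1_real_def c1_fun_simps dx_dy_diff)
  obtain f p q where lim: "(\<lambda>n. c1_fun (u n)) \<longlonglongrightarrow> f" "(\<lambda>n. dx (u n)) \<longlonglongrightarrow> p" "(\<lambda>n. dy (u n)) \<longlonglongrightarrow> q"
    using C[OF le(1)] C[OF le(2)] C[OF le(3)] by (auto simp: Cauchy_convergent_iff convergent_def)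
  have part: "has_partials f p q"
    using lim by (intro has_partials_limit[OF has_partials_dx_dy])
  have "f z \<in> \<real>" if "of_disc z \<in> sphere 0 1" for z
  proof (rule Lim_in_closed_set[OF closed_complex_Reals])
    show "\<forall>\<^sub>F n in sequentially. c1_fun (u n) z \<in> \<real>"
      using c1_fun that by auto
    show "(\<lambda>n. c1_fun (u n) z) \<longlonglongrightarrow> f z"
      by (rule tendsto_uniform_limitI[OF tendsto_bcontfun_uniform_limit[OF lim(1)]]) simp
  qed simp
  with part have "c1_fun (Abs_c1_real f) = f"
    by (intro Abs_c1_real_inverse) blast
  then obtain v where v: "f = c1_fun v" by metis
  then have d: "p = dx v" "q = dy v" using part dx_dy_eqI by auto
  have "(\<lambda>n. norm (c1_fun (u n) - c1_fun v) + norm (dx (u n) - dx v) + norm (dy (u n) - dy v)) \<longlonglongrightarrow> 0 + 0 + 0"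
    using lim unfolding v d by (intro tendsto_add tendsto_norm_zero LIM_zero)
  then have "(\<lambda>n. norm (u n - v)) \<longlonglongrightarrow> 0"
    by (simp add: norm_c1_real_def c1_fun_simps dx_dy_diff)
  then have "u \<longlonglongrightarrow> v"
    by (simp add: tendsto_norm_zero_iff LIM_zero_iff)
  then show "convergent u" by (rule convergentI)
qed

definition cauchy_riemann :: "c1_real \<Rightarrow> (disc \<Rightarrow>\<^sub>C complex)"
  where "cauchy_riemann u = Bcontfun (\<lambda>z. 1 / 2 * (dx u z + \<i> * dy u z))"

lemma cauchy_riemann_apply: "cauchy_riemann u z = 1 / 2 * (dx u z + \<i> * dy u z)"
proof -
  have "(\<lambda>z. 1 / 2 * (dx u z + \<i> * dy u z)) \<in> bcontfun"
    unfolding bcontfun_disc by (intro continuous_intros continuous_on_apply_bcontfun)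
  then show ?thesis by (simp add: cauchy_riemann_def Bcontfun_inverse)
qed

lemma bounded_linear_cauchy_riemann: "bounded_linear cauchy_riemann"
proof (rule bounded_linear_intro[where K = 1])
  fix u v :: c1_real and c :: real
  show "cauchy_riemann (u + v) = cauchy_riemann u + cauchy_riemann v"
    by (rule bcontfun_eqI) (simp add: cauchy_riemann_apply dx_dy_add field_simps)
  show "cauchy_riemann (c *\<^sub>R u) = c *\<^sub>R cauchy_riemann u"
    by (rule bcontfun_eqI)
      (simp add: cauchy_riemann_apply dx_dy_scaleR scaleR_conv_of_real field_simps)
  show "norm (cauchy_riemann u) \<le> norm u * 1"
  proof (rule norm_bound)
    fix z
    have "norm (cauchy_riemann u z) = norm (dx u z + \<i> * dy u z) / 2"
      by (simp add: cauchy_riemann_apply norm_divide)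
    also have "\<dots> \<le> norm (dx u z + \<i> * dy u z)" by simp
    also have "\<dots> \<le> norm (dx u z) + norm (dy u z)"
      using norm_triangle_ineq[of "dx u z" "\<i> * dy u z"] by (simp add: norm_mult)
    also have "\<dots> \<le> norm u * 1"
      using norm_bounded[of "dx u" z] norm_bounded[of "dy u" z] norm_ge_zero[of "c1_fun u"]
      unfolding norm_c1_real_def mult_1_right by linarith
    finally show "norm (cauchy_riemann u z) \<le> norm u * 1" .
  qed
qed

context
  includes blinfun.lifting
begin

lift_definition dbar :: "c1_real \<Rightarrow>\<^sub>L (disc \<Rightarrow>\<^sub>C complex)" is cauchy_riemann
  by (rule bounded_linear_cauchy_riemann)

end

instance bcontfun :: (metric_space, banach) banach ..

definition kernel :: "('a::real_normed_vector \<Rightarrow>\<^sub>L 'b::real_normed_vector) \<Rightarrow> 'a set"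
  where "kernel T = {x. T x = 0}"

definition coset_rel :: "('a::real_normed_vector \<Rightarrow>\<^sub>L 'b::real_normed_vector) \<Rightarrow> ('b \<times> 'b) set"
  where "coset_rel T = {(y, y'). y - y' \<in> range T}"

definition cokernel :: "('a::real_normed_vector \<Rightarrow>\<^sub>L 'b::real_normed_vector) \<Rightarrow> 'b set set"
  where "cokernel T = UNIV // coset_rel T"

text \<open>
  The classes of the elements of \<^term>\<open>span C\<close> are the linear combinations of the classes of the
  elements of \<^term>\<open>C\<close>, so that the second conjunct says that the quotient vector space
  \<^term>\<open>cokernel T\<close> is spanned by finitely many elements.
\<close>

definition fredholm :: "('a::banach \<Rightarrow>\<^sub>L 'b::banach) \<Rightarrow> bool"
  where "fredholm T \<longleftrightarrow>
    (\<exists>B. finite B \<and> span B = kernel T) \<and>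
    (\<exists>C. finite C \<and> (\<lambda>y. coset_rel T `` {y}) ` span C = cokernel T)"

end

theory Submission
  imports Defs "HOL-Complex_Analysis.Complex_Analysis" "HOL-Real_Asymp.Real_Asymp"
begin

text \<open>
  The function \<open>v\<^sub>p(z) = (z - p) ln (ln (16 / \<bar>z - p\<bar>\<^sup>2))\<close> is not differentiable at \<open>p\<close>, but its
  \<open>\<partial>\<close>-bar derivative \<open>f\<^sub>p\<close> extends continuously by \<open>0\<close> to \<open>p\<close>. If a finite real combination of the
  \<open>f\<^sub>p\<close> were \<open>\<partial>\<close>-bar of a \<open>C\<^sup>1\<close> function \<open>u\<close>, then \<open>u\<close> minus the same combination of the \<open>v\<^sub>p\<close> would
  be continuous, and holomorphic off finitely many points, hence holomorphic; so the combination of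
  the \<open>v\<^sub>p\<close> would be differentiable, which forces all coefficients to vanish. Thus the \<open>f\<^sub>p\<close> for \<open>p\<close> in
  the open disc are linearly independent modulo the image, and the cokernel is infinite-dimensional.
\<close>

section \<open>Linear algebra: a criterion for an infinite-dimensional cokernel\<close>

text \<open>If the classes of \<open>span C\<close> exhaust the cokernel, each \<open>f i\<close> is
  congruent modulo the range to some \<open>s i\<close> in \<open>span C\<close>. Linear relations
  among the \<open>s i\<close> pass to the \<open>f i\<close> modulo the range, so
  \<open>card C + 1\<close> of the \<open>s i\<close> would be independent, against the exchange
  bound.\<close>

lemma not_fredholm_if_independent_mod_range:
  fixes f :: "'i \<Rightarrow> 'b::banach" and T :: "'a::banach \<Rightarrow>\<^sub>L 'b"
  assumes "infinite I"
    and indep: "\<And>P c i. \<lbrakk>finite P; P \<subseteq> I; (\<Sum>i\<in>P. c i *\<^sub>R f i) \<in> range T; i \<in> P\<rbrakk> \<Longrightarrow> c i = 0"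
  shows "\<not> fredholm T"
proof
  assume "fredholm T"
  then obtain C where C: "finite C" "(\<lambda>y. coset_rel T `` {y}) ` span C = cokernel T"
    unfolding fredholm_def by blast
  have sub: "subspace (range T)"
    by (intro linear_subspace_image blinfun.bounded_linear_right bounded_linear.linear subspace_UNIV)
  have "\<exists>s\<in>span C. s - f i \<in> range T" for i
  proof -
    have "coset_rel T `` {f i} \<in> cokernel T"
      unfolding cokernel_def by (rule quotientI) simp
    then obtain s where s: "s \<in> span C" "coset_rel T `` {f i} = coset_rel T `` {s}"
      using C(2) by blast
    have "f i \<in> coset_rel T `` {f i}"
      using subspace_0[OF sub] by (simp add: coset_rel_def)
    then have "s - f i \<in> range T"
      unfolding s(2) by (simp add: coset_rel_def)
    then show ?thesis using s(1) by blast
  qed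
  then obtain s where s: "\<And>i. s i \<in> span C" "\<And>i. s i - f i \<in> range T" by metis
  have zero: "c i = 0"
    if "finite P" "P \<subseteq> I" "(\<Sum>i\<in>P. c i *\<^sub>R s i) = 0" "i \<in> P" for P c i
  proof (rule indep[OF that(1,2) _ that(4)])
    \<comment> \<open>The sign is chosen so that the \<open>s i\<close> cancel by the assumed
      relation and exactly the combination of the \<open>f i\<close> remains.\<close>
    have "(\<Sum>i\<in>P. (- c i) *\<^sub>R (s i - f i)) \<in> range T"
      by (intro subspace_sum subspace_scale sub s)
    also have "(\<Sum>i\<in>P. (- c i) *\<^sub>R (s i - f i)) = (\<Sum>i\<in>P. c i *\<^sub>R f i)"
      using that(3) by (simp add: scaleR_diff_right sum_subtractf sum_negf)
    finally show "(\<Sum>i\<in>P. c i *\<^sub>R f i) \<in> range T" .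
  qed
  obtain P where P: "finite P" "card P = Suc (card C)" "P \<subseteq> I"
    using infinite_arbitrarily_large[OF \<open>infinite I\<close>] by blast
  have inj: "inj_on s P"
  \<comment> \<open>A coincidence \<open>s i = s j\<close> is itself a relation, with coefficients
    \<open>1\<close> and \<open>- 1\<close>.\<close>
  proof (rule inj_onI, rule ccontr)
    fix i j assume ij: "i \<in> P" "j \<in> P" "s i = s j" "i \<noteq> j"
    have "(if i = i then 1 else - 1 :: real) = 0"
      by (rule zero[of "{i, j}" "\<lambda>k. if k = i then 1 else - 1"]) (use ij P(3) in auto)
    then show False by simp
  qed
  have "independent (s ` P)"
  proof
    assume "dependent (s ` P)"
    then obtain u v where u: "v \<in> s ` P" "u v \<noteq> 0" "(\<Sum>v\<in>s ` P. u v *\<^sub>R v) = 0"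
      using dependent_finite[of "s ` P"] P(1) by blast
    then have "(\<Sum>i\<in>P. u (s i) *\<^sub>R s i) = 0"
      by (simp add: sum.reindex[OF inj])
    from zero[OF P(1,3) this] u(1,2) show False by blast
  qed
  then have "card (s ` P) \<le> card C"
    using independent_span_bound[OF C(1)] s(1) by blast
  then show False using P(2) by (simp add: card_image[OF inj])
qed

section \<open>The pointwise Cauchy-Riemann operator\<close>

text \<open>\<open>D 1\<close> and \<open>D \<i>\<close> are the partial derivatives in x and y; the
  factor \<open>2\<close> clears the one half in the operator.\<close>

definition has_dbar :: "(complex \<Rightarrow> complex) \<Rightarrow> complex \<Rightarrow> complex \<Rightarrow> bool"
  where "has_dbar f c z \<longleftrightarrow> (\<exists>D. (f has_derivative D) (at z) \<and> D 1 + \<i> * D \<i> = 2 * c)"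

lemma has_dbar_diff:
  assumes "has_dbar f a z" "has_dbar g b z"
  shows "has_dbar (\<lambda>w. f w - g w) (a - b) z"
proof -
  obtain D E where "(f has_derivative D) (at z)" "D 1 + \<i> * D \<i> = 2 * a"
    "(g has_derivative E) (at z)" "E 1 + \<i> * E \<i> = 2 * b"
    using assms unfolding has_dbar_def by blast
  then show ?thesis
    unfolding has_dbar_def
    by (intro exI[of _ "\<lambda>h. D h - E h"] conjI has_derivative_diff) (auto simp: algebra_simps)
qed

lemma has_dbar_sum_scaleR:
  assumes "\<And>i. i \<in> P \<Longrightarrow> has_dbar (f i) (a i) z"
  shows "has_dbar (\<lambda>w. \<Sum>i\<in>P. c i *\<^sub>R f i w) (\<Sum>i\<in>P. c i *\<^sub>R a i) z"
proof -
  obtain D where D: "\<And>i. i \<in> P \<Longrightarrow> (f i has_derivative D i) (at z)"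
    "\<And>i. i \<in> P \<Longrightarrow> D i 1 + \<i> * D i \<i> = 2 * a i"
    using assms unfolding has_dbar_def by metis
  have "(\<Sum>i\<in>P. c i *\<^sub>R D i 1) + \<i> * (\<Sum>i\<in>P. c i *\<^sub>R D i \<i>) = (\<Sum>i\<in>P. c i *\<^sub>R (D i 1 + \<i> * D i \<i>))"
    by (simp add: sum_distrib_left scaleR_add_right sum.distrib)
  also have "\<dots> = 2 * (\<Sum>i\<in>P. c i *\<^sub>R a i)"
    by (simp add: D(2) sum_distrib_left)
  finally show ?thesis
    unfolding has_dbar_def
    by (intro exI[of _ "\<lambda>h. \<Sum>i\<in>P. c i *\<^sub>R D i h"] conjI has_derivative_sum
        has_derivative_scaleR_right D(1)) auto
qed

text \<open>The Cauchy-Riemann equation forces \<open>D \<i> = \<i> * D 1\<close>, so the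
  real-linear \<open>D\<close> is multiplication by the complex number \<open>D 1\<close>.\<close>

lemma has_dbar_0_imp_field_differentiable:
  assumes "has_dbar f 0 z"
  shows "f field_differentiable at z"
proof -
  obtain D where D: "(f has_derivative D) (at z)" "D 1 + \<i> * D \<i> = 0"
    using assms unfolding has_dbar_def by auto
  have lin: "linear D" using has_derivative_linear[OF D(1)] .
  have Di: "D \<i> = \<i> * D 1"
  proof -
    have "\<i> * (D 1 + \<i> * D \<i>) = \<i> * D 1 - D \<i>"
      by (simp add: algebra_simps flip: mult.assoc)
    then show ?thesis using D(2) by simp
  qed
  have "D = (*) (D 1)"
  proof
    fix h
    have "D h = D (Re h *\<^sub>R 1 + Im h *\<^sub>R \<i>)"
      by (rule arg_cong[of _ _ D]) (simp add: complex_eq_iff)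
    also have "\<dots> = Re h *\<^sub>R D 1 + Im h *\<^sub>R D \<i>"
      using lin by (simp only: linear_add linear_scale)
    also have "\<dots> = D 1 * (of_real (Re h) + \<i> * of_real (Im h))"
      unfolding Di by (simp add: scaleR_conv_of_real algebra_simps)
    finally show "D h = D 1 * h" by (simp flip: complex_eq)
  qed
  then have "(f has_field_derivative D 1) (at z)"
    using D(1) by (simp add: has_field_derivative_def)
  then show ?thesis by (auto simp: field_differentiable_def)
qed

section \<open>The singular functions and their d-bar derivatives\<close>

text \<open>
  The constant \<open>16\<close> keeps \<open>16 / \<bar>z - p\<bar>\<^sup>2\<close> above \<open>4\<close> for \<open>z\<close> and \<open>p\<close> in the closed unit disc. At
  \<open>z = p\<close> the conventions for division by \<open>0\<close> give the value \<open>0\<close>, which is the limit.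
\<close>

definition loglog :: "complex \<Rightarrow> complex \<Rightarrow> complex"
  where "loglog p z = (z - p) * of_real (ln (ln (16 / (cmod (z - p))\<^sup>2)))"

definition dbar_loglog :: "complex \<Rightarrow> complex \<Rightarrow> complex"
  where "dbar_loglog p z = - ((z - p)\<^sup>2 / of_real ((cmod (z - p))\<^sup>2 * ln (16 / (cmod (z - p))\<^sup>2)))"

lemma ln_sixteen_div_pos:
  fixes z p :: complex
  assumes "z \<in> cball 0 1" "p \<in> cball 0 1" "z \<noteq> p"
  shows "ln (16 / (cmod (z - p))\<^sup>2) > 0"
proof (rule ln_gt_zero)
  have "cmod (z - p) \<le> 2"
    using norm_triangle_ineq4[of z p] assms by simp
  then have "(cmod (z - p))\<^sup>2 \<le> 2\<^sup>2" by (rule power_mono) simp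
  moreover have "(cmod (z - p))\<^sup>2 > 0" using assms by simp
  ultimately show "16 / (cmod (z - p))\<^sup>2 > 1" by (simp add: field_simps)
qed

text \<open>Since \<open>z - p\<close> is holomorphic, only the real factor contributes. For
  \<open>t = (cmod (z - p))\<^sup>2\<close> the d-bar derivative of \<open>t\<close> is
  \<open>z - p\<close>, and the chain rule multiplies it by \<open>L'\<close>.\<close>

lemma has_dbar_loglog:
  assumes "z \<in> cball 0 1" "p \<in> cball 0 1" "z \<noteq> p"
  shows "has_dbar (loglog p) (dbar_loglog p z) z"
proof -
  define t where "t = (cmod (z - p))\<^sup>2"
  define L' where "L' = - 1 / (t * ln (16 / t))"
  have t: "t > 0" "ln (16 / t) > 0"
    using ln_sixteen_div_pos[OF assms] assms(3) by (simp_all add: t_def)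
  have L: "((\<lambda>t. ln (ln (16 / t))) has_real_derivative L') (at t)"
    using t unfolding L'_def by (auto intro!: derivative_eq_intros simp: field_simps power2_eq_square)
  have N: "((\<lambda>z. (cmod (z - p))\<^sup>2) has_derivative
      (\<lambda>h. 2 * (Re (z - p) * Re h + Im (z - p) * Im h))) (at z)"
    unfolding cmod_power2 by (auto intro!: derivative_eq_intros simp: algebra_simps)
  have "((\<lambda>z. ln (ln (16 / (cmod (z - p))\<^sup>2))) has_derivative
      (\<lambda>h. 2 * (Re (z - p) * Re h + Im (z - p) * Im h) * L')) (at z)"
    using has_derivative_compose[OF N L[unfolded t_def has_field_derivative_def]]
    by (simp add: mult.commute)
  from has_derivative_mult[OF has_derivative_diff[OF has_derivative_ident has_derivative_const[of p]]
      has_derivative_of_real[OF this]]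
  have D: "(loglog p has_derivative (\<lambda>h. (z - p) * of_real (2 * (Re (z - p) * Re h + Im (z - p) * Im h) * L')
      + (h - 0) * of_real (ln (ln (16 / (cmod (z - p))\<^sup>2))))) (at z)"
    by (simp only: loglog_def[abs_def])
  have e: "dbar_loglog p z = (z - p)\<^sup>2 * of_real L'"
    by (simp add: dbar_loglog_def L'_def t_def)
  \<comment> \<open>Here \<open>l\<close> stands for the double logarithm; its two terms cancel
    because \<open>1 + \<i> * \<i> = 0\<close>.\<close>
  have eq: "(z - p) * of_real (2 * (x * 1 + y * 0) * L') + (1 - 0) * of_real l
      + \<i> * ((z - p) * of_real (2 * (x * 0 + y * 1) * L') + (\<i> - 0) * of_real l)
      = 2 * (z - p) * of_real L' * (of_real x + \<i> * of_real y)" for x y l :: real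
    by (simp add: algebra_simps)
  have eq': "2 * (z - p) * of_real L' * (of_real (Re (z - p)) + \<i> * of_real (Im (z - p))) = 2 * dbar_loglog p z"
    unfolding e complex_eq[symmetric] by (simp add: power2_eq_square)
  show ?thesis
    unfolding has_dbar_def
    by (intro exI conjI, rule D) (simp only: one_complex.sel imaginary_unit.sel eq eq')
qed

lemma filterlim_cmod_at_right_0: "filterlim (\<lambda>z. cmod (z - p)) (at_right 0) (at p)"
proof -
  have "((\<lambda>z. cmod (z - p)) \<longlongrightarrow> 0) (at p)"
    by (rule tendsto_eq_intros refl | simp)+
  moreover have "\<forall>\<^sub>F z in at p. cmod (z - p) \<in> {0<..}"
    by (simp add: eventually_at_filter)
  ultimately show ?thesis by (simp add: filterlim_at eventually_at_filter)
qed

lemma isCont_loglog: "isCont (loglog p) p"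
proof -
  have "((\<lambda>t::real. \<bar>t * ln (ln (16 / t\<^sup>2))\<bar>) \<longlongrightarrow> 0) (at_right 0)"
    by real_asymp
  from filterlim_compose[OF this filterlim_cmod_at_right_0]
  have "((\<lambda>z. norm (loglog p z)) \<longlongrightarrow> 0) (at p)"
    by (simp add: loglog_def norm_mult abs_mult)
  then have "(loglog p \<longlongrightarrow> 0) (at p)" by (rule tendsto_norm_zero_cancel)
  then show ?thesis by (simp add: isCont_def loglog_def)
qed

text \<open>The quotient of \<open>(z - p)\<^sup>2\<close> by its modulus has modulus one, so only
  the reciprocal of the logarithm governs the size, and it tends to \<open>0\<close>.\<close>

lemma isCont_dbar_loglog: "isCont (dbar_loglog p) p"
proof -
  have "((\<lambda>t::real. \<bar>1 / ln (16 / t\<^sup>2)\<bar>) \<longlongrightarrow> 0) (at_right 0)"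
    by real_asymp
  from filterlim_compose[OF this filterlim_cmod_at_right_0]
  have "((\<lambda>z. \<bar>1 / ln (16 / (cmod (z - p))\<^sup>2)\<bar>) \<longlongrightarrow> 0) (at p)" .
  moreover have "\<forall>\<^sub>F z in at p. \<bar>1 / ln (16 / (cmod (z - p))\<^sup>2)\<bar> = norm (dbar_loglog p z)"
    unfolding eventually_at_filter
    by (rule always_eventually) (simp add: dbar_loglog_def norm_divide norm_power norm_mult abs_mult)
  ultimately have "((\<lambda>z. norm (dbar_loglog p z)) \<longlongrightarrow> 0) (at p)"
    by (rule Lim_transform_eventually)
  then have "(dbar_loglog p \<longlongrightarrow> 0) (at p)" by (rule tendsto_norm_zero_cancel)
  then show ?thesis by (simp add: isCont_def dbar_loglog_def)
qed

lemma continuous_on_dbar_loglog: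
  assumes "p \<in> cball 0 1"
  shows "continuous_on (cball 0 1) (dbar_loglog p)"
  unfolding continuous_on_eq_continuous_within
proof
  fix z :: complex assume z: "z \<in> cball 0 1"
  have "isCont (dbar_loglog p) z"
  proof (cases "z = p")
    case False
    with ln_sixteen_div_pos[OF z assms False] show ?thesis
      unfolding dbar_loglog_def by (intro continuous_intros) auto
  qed (simp add: isCont_dbar_loglog)
  then show "continuous (at z within cball 0 1) (dbar_loglog p)"
    by (rule continuous_at_imp_continuous_at_within)
qed

text \<open>Along the ray \<open>p + t\<close> with \<open>t\<close> decreasing to \<open>0\<close>
  the difference quotient is \<open>ln (ln (16 / t\<^sup>2))\<close>, which is unbounded.\<close>

lemma loglog_not_differentiable: "\<not> loglog p differentiable (at p)"
proof
  assume "loglog p differentiable (at p)"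
  then obtain D where D: "(loglog p has_derivative D) (at p)"
    by (auto simp: differentiable_def)
  obtain K where K: "\<And>h. norm (D h) \<le> norm h * K"
    using bounded_linear.bounded[OF has_derivative_bounded_linear[OF D]] by blast
  \<comment> \<open>Error tolerance \<open>1\<close> suffices: it already bounds the difference
    quotients near \<open>p\<close> by \<open>K + 1\<close>.\<close>
  obtain d where d: "d > 0" "\<And>y. norm (y - p) < d \<Longrightarrow>
      norm (loglog p y - loglog p p - D (y - p)) \<le> 1 * norm (y - p)"
    using D unfolding has_derivative_at_alt by (meson zero_less_one)
  have "filterlim (\<lambda>t::real. ln (ln (16 / t\<^sup>2))) at_top (at_right 0)"
    by real_asymp
  then have "\<forall>\<^sub>F t in at_right 0. ln (ln (16 / t\<^sup>2)) > K + 1"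
    by (simp add: filterlim_at_top_dense)
  moreover have "\<forall>\<^sub>F t::real in at_right 0. t \<in> {0<..<d}"
    using d(1) by (rule eventually_at_right_real)
  ultimately have "\<forall>\<^sub>F t::real in at_right 0. False"
  proof eventually_elim
    case (elim t)
    define y where "y = p + of_real t"
    have y: "norm (y - p) = t" using elim by (simp add: y_def)
    have "norm (loglog p y) \<le> norm (loglog p y - D (y - p)) + norm (D (y - p))"
      using norm_triangle_ineq[of "loglog p y - D (y - p)" "D (y - p)"] by simp
    also have "\<dots> \<le> t + t * K"
      using d(2)[of y] K[of "y - p"] y elim by (simp add: loglog_def[of p p])
    also have "norm (loglog p y) = t * \<bar>ln (ln (16 / t\<^sup>2))\<bar>"
      by (simp add: loglog_def norm_mult y)
    finally have "t * \<bar>ln (ln (16 / t\<^sup>2))\<bar> \<le> t * (1 + K)" by (simp add: algebra_simps)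
    then show False using elim by (simp add: mult_le_cancel_left)
  qed
  then show False by simp
qed

section \<open>Independence by removal of singularities\<close>

lemma independent_loglog_mod_differentiable:
  fixes P :: "complex set"
  assumes P: "finite P" "P \<subseteq> ball 0 1" and p: "p \<in> P"
    and u: "\<And>z. z \<in> ball 0 1 \<Longrightarrow> has_dbar u (\<Sum>q\<in>P. c q *\<^sub>R dbar_loglog q z) z"
  shows "c p = 0"
proof (rule ccontr)
  assume "c p \<noteq> 0"
  define w where "w z = u z - (\<Sum>q\<in>P. c q *\<^sub>R loglog q z)" for z
  have diff: "u differentiable (at z)" if "z \<in> ball 0 1" for z
    using u[OF that] by (auto simp: has_dbar_def differentiable_def)
  have loglog_diff: "loglog q differentiable (at z)" if "q \<in> ball 0 1" "z \<in> ball 0 1" "z \<noteq> q" for q z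
    using has_dbar_loglog[of z q] that by (auto simp: has_dbar_def differentiable_def)
  have "continuous_on (ball 0 1) w"
  proof (rule continuous_at_imp_continuous_on, rule ballI)
    fix z :: complex assume z: "z \<in> ball 0 1"
    have "isCont (loglog q) z" if "q \<in> P" for q
    proof (cases "z = q")
      case False
      then show ?thesis
        using P(2) that z by (intro differentiable_imp_continuous_within loglog_diff) auto
    qed (simp add: isCont_loglog)
    then show "isCont w z"
      unfolding w_def using differentiable_imp_continuous_within[OF diff[OF z]]
      by (intro continuous_intros) auto
  qed
  moreover have "w holomorphic_on (ball 0 1 - P)"
    unfolding holomorphic_on_def
  proof
    fix z assume z: "z \<in> ball 0 1 - P"
    have "has_dbar (\<lambda>z. \<Sum>q\<in>P. c q *\<^sub>R loglog q z) (\<Sum>q\<in>P. c q *\<^sub>R dbar_loglog q z) z"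
      by (rule has_dbar_sum_scaleR, rule has_dbar_loglog) (use z P(2) in auto)
    from has_dbar_diff[OF u this] z have "has_dbar w 0 z"
      by (simp add: w_def[abs_def])
    then show "w field_differentiable at z within ball 0 1 - P"
      by (rule field_differentiable_at_within[OF has_dbar_0_imp_field_differentiable])
  qed
  \<comment> \<open>The finitely many points of \<open>P\<close> are removable because
    \<open>w\<close> is continuous there.\<close>
  ultimately have "w holomorphic_on ball 0 1"
    by (rule no_isolated_singularity) (rule open_ball P(1))+
  then have "w field_differentiable (at p)"
    by (rule holomorphic_on_imp_differentiable_at[OF _ open_ball]) (use p P(2) in blast)
  then have wd: "w differentiable (at p)"
    by (rule field_differentiable_imp_differentiable)
  \<comment> \<open>\<open>g\<close> collects the terms singular at points other than
    \<open>p\<close>, hence differentiable at \<open>p\<close>; this isolates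
    \<open>loglog p\<close>.\<close>
  define g where "g z = (\<Sum>q\<in>P - {p}. c q *\<^sub>R loglog q z)" for z
  have gd: "g differentiable (at p)"
    unfolding g_def
    by (intro differentiable_sum ballI differentiable_scaleR differentiable_const loglog_diff) (use P p in auto)
  have "loglog p = (\<lambda>z. inverse (c p) *\<^sub>R (u z - w z - g z))"
  proof
    fix z
    have "u z - w z - g z = c p *\<^sub>R loglog p z"
      using sum.remove[OF P(1) p, of "\<lambda>q. c q *\<^sub>R loglog q z"] by (simp add: w_def g_def)
    then show "loglog p z = inverse (c p) *\<^sub>R (u z - w z - g z)" using \<open>c p \<noteq> 0\<close> by simp
  qed
  moreover have "(\<lambda>z. inverse (c p) *\<^sub>R (u z - w z - g z)) differentiable (at p)"
    by (intro differentiable_scaleR differentiable_diff differentiable_const diff wd gd) (use p P(2) in blast)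
  ultimately show False using loglog_not_differentiable[of p] by simp
qed

section \<open>Transfer to the operator on the closed disc\<close>

text \<open>At an interior point the derivative relative to the closed disc is the full derivative,
  and it sees only nearby values, where \<open>to_disc\<close> inverts
  \<open>of_disc\<close>.\<close>

lemma has_dbar_c1_fun:
  assumes "z \<in> ball 0 1"
  shows "has_dbar (\<lambda>w. c1_fun u (to_disc w)) (dbar u (to_disc z)) z"
proof -
  have z: "of_disc (to_disc z) = z"
    using assms by (intro to_disc_inverse) auto
  have at: "at z within cball 0 1 = at z"
    using assms by (intro at_within_interior) auto
  have "((\<lambda>w. c1_fun u (to_disc w)) has_derivative
      (\<lambda>h. Re h *\<^sub>R dx u (to_disc z) + Im h *\<^sub>R dy u (to_disc z))) (at z)"
    using has_partials_dx_dy[of u, unfolded has_partials_def, THEN spec, of "to_disc z"]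
    by (simp only: z at)
  then show ?thesis
    unfolding has_dbar_def by (intro exI conjI, assumption) (simp add: dbar.rep_eq cauchy_riemann_apply)
qed

definition disc_dbar_loglog :: "complex \<Rightarrow> (disc \<Rightarrow>\<^sub>C complex)"
  where "disc_dbar_loglog p = Bcontfun (\<lambda>z. dbar_loglog p (of_disc z))"

lemma disc_dbar_loglog_apply:
  assumes "p \<in> cball 0 1"
  shows "disc_dbar_loglog p z = dbar_loglog p (of_disc z)"
proof -
  have "continuous_on UNIV of_disc"
    unfolding continuous_on_iff dist_disc_def by auto
  then have "(\<lambda>z. dbar_loglog p (of_disc z)) \<in> bcontfun"
    unfolding bcontfun_disc
    by (rule continuous_on_compose2[OF continuous_on_dbar_loglog[OF assms]]) (use of_disc in auto)
  then show ?thesis by (simp add: disc_dbar_loglog_def Bcontfun_inverse)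
qed

lemma sum_scaleR_bcontfun_apply:
  fixes f :: "'i \<Rightarrow> 'a::topological_space \<Rightarrow>\<^sub>C 'b::real_normed_vector"
  shows "(\<Sum>i\<in>P. c i *\<^sub>R f i) x = (\<Sum>i\<in>P. c i *\<^sub>R f i x)"
  by (induction P rule: infinite_finite_induct) simp_all

theorem corollary3:
  shows "\<not> fredholm dbar"
proof (rule not_fredholm_if_independent_mod_range)
  show "infinite (ball (0::complex) 1)"
    by (metis countable_finite uncountable_ball zero_less_one)
  fix P :: "complex set" and c p
  assume P: "finite P" "P \<subseteq> ball 0 1" "p \<in> P"
    and range: "(\<Sum>p\<in>P. c p *\<^sub>R disc_dbar_loglog p) \<in> range dbar"
  then obtain u where u: "dbar u = (\<Sum>p\<in>P. c p *\<^sub>R disc_dbar_loglog p)" by auto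
  show "c p = 0"
  \<comment> \<open>The function fed to the independence lemma is the preimage \<open>u\<close>,
    read on the plane through \<open>to_disc\<close>.\<close>
  proof (rule independent_loglog_mod_differentiable[OF P])
    fix z :: complex assume z: "z \<in> ball 0 1"
    then have "of_disc (to_disc z) = z" by (intro to_disc_inverse) auto
    moreover have "q \<in> cball 0 1" if "q \<in> P" for q using that P(2) by auto
    ultimately have "dbar u (to_disc z) = (\<Sum>q\<in>P. c q *\<^sub>R dbar_loglog q z)"
      unfolding u sum_scaleR_bcontfun_apply by (intro sum.cong) (simp_all add: disc_dbar_loglog_apply)
    with has_dbar_c1_fun[OF z, of u]
    show "has_dbar (\<lambda>w. c1_fun u (to_disc w)) (\<Sum>q\<in>P. c q *\<^sub>R dbar_loglog q z) z" by simp
  qed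
qed

end
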